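(* Let $a>1/2$ and let $f_*(s)=\partial_s\bigl(A(s)\cosh\varphi(s)\bigr)$. For every $k\in\mathbb{Z}$ and every smooth function $u$ on $[-s_0,s_0]$ with $u(0)=0$, written as $u=f_*h$ with $h\in C^1([-s_0,s_0])$, one has $$\mathcal{S}_k^{\mathrm{rad}}(u,u)=(k^2-1)\int_{-s_0}^{s_0}\frac{f_*(s)^2}{B(s)}\,h(s)^2\,ds+\int_{-s_0}^{s_0}B(s)\,f_*(s)^2\,h'(s)^2\,ds.$$
   Context: For $a>1/2$ put $A(s)=\sqrt{a\cosh(2s)+\tfrac12}$, $B(s)=\sqrt{a\cosh(2s)-\tfrac12}$, $K=K(a)=\sqrt{a^2-\tfrac14}$, and $\varphi(s)=\int_0^s\frac{K}{A(t)^2B(t)}\,dt$. Let $s_0=s_0(a)>0$ be the unique positive solution of $\tanh\varphi(s_0)=\frac{B(s_0)K}{a\sinh(2s_0)}$, and let $r(a)>0$ be defined by $\cosh r(a)=A(s_0)\cosh\varphi(s_0)$. (Geometrically, these are the data of the critical spherical catenoid $\Sigma_a$, a rotational free boundary minimal annulus in the geodesic ball of radius $r(a)$ of hyperbolic space $\mathbb{H}^3$, with induced metric $ds^2+B(s)^2d\theta^2$, $|s|\le s_0$, and squared norm of the second fundamental form $|\mathrm{II}|^2=2K^2/B^4$.) For $k\in\mathbb{Z}$ set $W_k(s)=|\mathrm{II}|^2(s)-2-k^2/B(s)^2$ with $|\mathrm{II}|^2(s)=2K^2/B(s)^4$, and $$\mathcal{S}_k^{\mathrm{rad}}(u,u)=\int_{-s_0}^{s_0}\bigl[B(u')^2-BW_ku^2\bigr]ds-\coth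 r(a)\,B(s_0)\bigl[u(s_0)^2+u(-s_0)^2\bigr].$$ *)

theory Defs
  imports "HOL-Analysis.Analysis"
begin

definition cat_A :: "real \<Rightarrow> real \<Rightarrow> real"
  where "cat_A a s = sqrt (a * cosh (2 * s) + 1 / 2)"

definition cat_B :: "real \<Rightarrow> real \<Rightarrow> real"
  where "cat_B a s = sqrt (a * cosh (2 * s) - 1 / 2)"

definition cat_K :: "real \<Rightarrow> real"
  where "cat_K a = sqrt (a\<^sup>2 - 1 / 4)"

(* Interval integral, so that the value for s < 0 is the oriented one. *)
definition cat_phi :: "real \<Rightarrow> real \<Rightarrow> real"
  where "cat_phi a s = (LBINT t=0..s. cat_K a / ((cat_A a t)\<^sup>2 * cat_B a t))"

definition cat_s0 :: "real \<Rightarrow> real"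
  where "cat_s0 a =
    (THE s. s > 0 \<and> tanh (cat_phi a s) = cat_B a s * cat_K a / (a * sinh (2 * s)))"

definition cat_r :: "real \<Rightarrow> real"
  where "cat_r a =
    (THE r. r > 0 \<and> cosh r = cat_A a (cat_s0 a) * cosh (cat_phi a (cat_s0 a)))"

definition cat_I :: "real \<Rightarrow> real set"
  where "cat_I a = {- cat_s0 a .. cat_s0 a}"

definition coth :: "real \<Rightarrow> real"
  where "coth x = cosh x / sinh x"

(* Squared norm of the second fundamental form of the critical catenoid. *)
definition cat_II_sq :: "real \<Rightarrow> real \<Rightarrow> real"
  where "cat_II_sq a s = 2 * (cat_K a)\<^sup>2 / (cat_B a s) ^ 4"

definition cat_W :: "real \<Rightarrow> int \<Rightarrow> real \<Rightarrow> real"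
  where "cat_W a k s = cat_II_sq a s - 2 - (of_int k)\<^sup>2 / (cat_B a s)\<^sup>2"

(* Derivative relative to S: one-sided at the endpoints of an interval S. *)
definition deriv_within :: "real set \<Rightarrow> (real \<Rightarrow> real) \<Rightarrow> real \<Rightarrow> real"
  where "deriv_within S u s = vector_derivative u (at s within S)"

(* The value S_k^rad(u,u) of the radial index form. *)
definition S_rad :: "real \<Rightarrow> int \<Rightarrow> (real \<Rightarrow> real) \<Rightarrow> real"
  where "S_rad a k u =
    integral (cat_I a)
      (\<lambda>s. cat_B a s * (deriv_within (cat_I a) u s)\<^sup>2 - cat_B a s * cat_W a k s * (u s)\<^sup>2)
    - coth (cat_r a) * cat_B a (cat_s0 a) * ((u (cat_s0 a))\<^sup>2 + (u (- cat_s0 a))\<^sup>2)"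

definition f_star :: "real \<Rightarrow> real \<Rightarrow> real"
  where "f_star a s = deriv (\<lambda>t. cat_A a t * cosh (cat_phi a t)) s"

definition C1_on :: "real set \<Rightarrow> (real \<Rightarrow> real) \<Rightarrow> bool"
  where "C1_on S h \<longleftrightarrow>
    (\<exists>D. (\<forall>x\<in>S. (h has_real_derivative D x) (at x within S)) \<and> continuous_on S D)"

(* D n is the n-th derivative of u relative to S. *)
definition smooth_on :: "real set \<Rightarrow> (real \<Rightarrow> real) \<Rightarrow> bool"
  where "smooth_on S u \<longleftrightarrow>
    (\<exists>D :: nat \<Rightarrow> real \<Rightarrow> real.
      (\<forall>x\<in>S. D 0 x = u x) \<and>
      (\<forall>n. \<forall>x\<in>S. (D n has_real_derivative D (Suc n) x) (at x within S)))"

end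

theory Submission
  imports Defs "HOL-Real_Asymp.Real_Asymp"
begin

text \<open>
  The surface sits in the hyperboloid model as
  \<open>(A cosh \<phi>, A sinh \<phi>, B cos \<theta>, B sin \<theta>)\<close>, and coordinate functions of a minimal surface in
  hyperbolic space satisfy \<open>\<Delta>x = 2x\<close>. For the height \<open>F = A cosh \<phi>\<close>, which depends on \<open>s\<close> only,
  this reads \<open>(B F')' = 2 B F\<close>. Differentiating once more shows that \<open>f = F'\<close>, which is the given
  \<open>f\<^sub>*\<close>, solves \<open>(B f')' + B W\<^sub>1 f = 0\<close> (\<open>jacobi_equation\<close>), the Euler-Lagrange equation
  of the index form for \<open>k = 1\<close>.

  With such a solution at hand, inserting \<open>u = f h\<close> in the form gives
  \<open>B u'\<^sup>2 - B W\<^sub>k u\<^sup>2 = (B f f' h\<^sup>2)' + (k\<^sup>2 - 1) f\<^sup>2 h\<^sup>2 / B + B f\<^sup>2 h'\<^sup>2\<close>, where the factor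
  \<open>k\<^sup>2 - 1\<close> is what is left of \<open>W\<^sub>1 - W\<^sub>k\<close> (\<open>ground_state_substitution\<close>). The boundary terms
  cancel those of the form precisely when \<open>f' = coth r f\<close> at \<open>s\<^sub>0\<close>. This is the free boundary
  condition: the defining equation of \<open>s\<^sub>0\<close> forces \<open>F\<^sup>2 - F'\<^sup>2 = 1\<close> and \<open>F'' = F\<close> there
  (\<open>boundary_data\<close>), so that \<open>F = cosh r\<close>, \<open>f = sinh r\<close> and \<open>f' = cosh r\<close>. Since \<open>f\<close> is odd and \<open>B\<close>
  even, the other end behaves in the same way. The parameter \<open>s\<^sub>0\<close> and the radius \<open>r\<close> are given by
  descriptions, hence their existence and uniqueness are part of the proof: \<open>tanh \<phi>\<close> increases
  from \<open>0\<close> while the right-hand side decreases to \<open>0\<close> from a pole at \<open>0\<close>.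

  Finally, \<open>f\<close> vanishes only at \<open>0\<close> and \<open>f'(0) = 2 F(0) > 0\<close>, so every smooth \<open>u\<close> with
  \<open>u 0 = 0\<close> has the form \<open>f h\<close> with \<open>h\<close> continuously differentiable: divide \<open>u\<close> and \<open>f\<close> by \<open>s\<close>
  and take the quotient (\<open>C1_quotient_at_simple_zero\<close>).
\<close>

section \<open>Division by functions with a simple zero\<close>

text \<open>
  Away from \<open>0\<close> this is the quotient rule. At \<open>0\<close>, both the difference quotient of \<open>u x / x\<close> and
  the derivative \<open>(x u' - u) / x\<^sup>2\<close> tend to \<open>u''(0) / 2\<close> by de l'Hopital's rule, which is why one
  derivative is lost.
\<close>
lemma C1_on_divide_ident:
  fixes u u1 u2 :: "real \<Rightarrow> real" and c :: real
  assumes c: "c > 0" and u0: "u 0 = 0"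
    and du: "\<And>x. x \<in> {-c..c} \<Longrightarrow> (u has_real_derivative u1 x) (at x within {-c..c})"
    and du1: "\<And>x. x \<in> {-c..c} \<Longrightarrow> (u1 has_real_derivative u2 x) (at x within {-c..c})"
    and cont: "continuous_on {-c..c} u2"
  shows "C1_on {-c..c} (\<lambda>x. if x = 0 then u1 0 else u x / x)"
proof -
  let ?S = "{-c..c}"
  define U where "U = (\<lambda>x. if x = 0 then u1 0 else u x / x)"
  define V where "V = (\<lambda>x. if x = 0 then u2 0 / 2 else (u1 x * x - u x) / x\<^sup>2)"
  have at_S: "at x within ?S = at x" if "x \<in> {-c<..<c}" for x
    using that by (intro at_within_interior) auto
  have ev: "eventually (\<lambda>x. x \<in> {-c<..<c}) (at 0)"
    using c by (intro eventually_at_in_open') auto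
  have du': "(u has_real_derivative u1 x) (at x)" if "x \<in> {-c<..<c}" for x
    using du[of x] at_S[OF that] that by auto
  have du1': "(u1 has_real_derivative u2 x) (at x)" if "x \<in> {-c<..<c}" for x
    using du1[of x] at_S[OF that] that by auto
  have zero: "0 \<in> {-c<..<c}" using c by simp
  have u_lim: "(u \<longlongrightarrow> 0) (at 0)"
    using DERIV_isCont[OF du'[OF zero]] u0 by (simp add: isCont_def)
  have u1_lim: "(u1 \<longlongrightarrow> u1 0) (at 0)"
    using DERIV_isCont[OF du1'[OF zero]] by (simp add: isCont_def)
  have u2_lim: "(u2 \<longlongrightarrow> u2 0) (at 0)"
    using cont c at_S[OF zero] unfolding continuous_on_def
    by (auto dest: bspec[where x = 0])
  have nz: "eventually (\<lambda>x::real. x \<noteq> 0) (at 0)"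
    by (rule eventually_at_filter[THEN iffD2]) auto
  have slope: "((\<lambda>x. (u x - x * u1 0) / x\<^sup>2) \<longlongrightarrow> u2 0 / 2) (at 0)"
  proof (rule lhopital[where f' = "\<lambda>x. u1 x - u1 0" and g' = "\<lambda>x. 2 * x"])
    show "((\<lambda>x. u x - x * u1 0) \<longlongrightarrow> 0) (at 0)"
      using u_lim by (auto intro!: tendsto_eq_intros)
    show "((\<lambda>x::real. x\<^sup>2) \<longlongrightarrow> 0) (at 0)"
      by (auto intro!: tendsto_eq_intros)
    show "eventually (\<lambda>x. ((\<lambda>x. u x - x * u1 0) has_real_derivative u1 x - u1 0) (at x)) (at 0)"
      using ev by eventually_elim (auto intro!: derivative_eq_intros du')
    show "eventually (\<lambda>x::real. ((\<lambda>x. x\<^sup>2) has_real_derivative 2 * x) (at x)) (at 0)"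
      by (auto intro!: always_eventually derivative_eq_intros)
    have "((\<lambda>x. (u1 x - u1 0) / (x - 0)) \<longlongrightarrow> u2 0) (at 0)"
      using du1'[OF zero] by (simp only: has_field_derivative_iff)
    from tendsto_divide[OF this tendsto_const[of 2]]
    show "((\<lambda>x. (u1 x - u1 0) / (2 * x)) \<longlongrightarrow> u2 0 / 2) (at 0)"
      by (simp add: mult.commute)
  qed (use nz in auto)
  have slope': "((\<lambda>x. (u1 x * x - u x) / x\<^sup>2) \<longlongrightarrow> u2 0 / 2) (at 0)"
  proof (rule lhopital[where f' = "\<lambda>x. u2 x * x" and g' = "\<lambda>x. 2 * x"])
    show "((\<lambda>x. u1 x * x - u x) \<longlongrightarrow> 0) (at 0)"
      using u_lim u1_lim by (auto intro!: tendsto_eq_intros)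
    show "((\<lambda>x::real. x\<^sup>2) \<longlongrightarrow> 0) (at 0)"
      by (auto intro!: tendsto_eq_intros)
    show "eventually (\<lambda>x. ((\<lambda>x. u1 x * x - u x) has_real_derivative u2 x * x) (at x)) (at 0)"
      using ev by eventually_elim (auto intro!: derivative_eq_intros du' du1')
    show "eventually (\<lambda>x::real. ((\<lambda>x. x\<^sup>2) has_real_derivative 2 * x) (at x)) (at 0)"
      by (auto intro!: always_eventually derivative_eq_intros)
    have "((\<lambda>x. u2 x / 2) \<longlongrightarrow> u2 0 / 2) (at 0)"
      by (intro tendsto_intros u2_lim) simp
    then show "((\<lambda>x. u2 x * x / (2 * x)) \<longlongrightarrow> u2 0 / 2) (at 0)"
      by (rule Lim_transform_eventually) (use nz in eventually_elim, simp)
  qed (use nz in auto)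
  have dU: "(U has_real_derivative V x) (at x within ?S)" if x: "x \<in> ?S" for x
  proof (cases "x = 0")
    case True
    have "((\<lambda>y. (U y - U 0) / (y - 0)) \<longlongrightarrow> V 0) (at 0)"
      unfolding V_def using slope
      by (simp, elim Lim_transform_eventually)
        (use nz in eventually_elim, simp add: U_def field_simps power2_eq_square)
    then have "(U has_real_derivative V 0) (at 0)"
      by (simp only: has_field_derivative_iff)
    then show ?thesis using True at_S[OF zero] by simp
  next
    case False
    have "((\<lambda>x. u x / x) has_real_derivative V x) (at x within ?S)"
      using False by (auto intro!: derivative_eq_intros du x simp: V_def power2_eq_square)
    then show ?thesis
      by (rule has_field_derivative_transform_within[where d = "\<bar>x\<bar>"])
        (use False x in \<open>auto simp: U_def dist_real_def\<close>)
  qed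
  have cu: "continuous_on ?S u" "continuous_on ?S u1"
    by (rule DERIV_continuous_on[OF du], assumption) (rule DERIV_continuous_on[OF du1])
  have "continuous (at x within ?S) V" if x: "x \<in> ?S" for x
  proof (cases "x = 0")
    case True
    have "(V \<longlongrightarrow> V 0) (at 0)"
      using slope' unfolding V_def
      by (simp, elim Lim_transform_eventually) (use nz in eventually_elim, simp)
    then show ?thesis using True at_S[OF zero] by (simp add: continuous_within)
  next
    case False
    have "continuous (at x within ?S) (\<lambda>x. (u1 x * x - u x) / x\<^sup>2)"
      using cu x False
      by (auto intro!: continuous_intros simp: continuous_on_eq_continuous_within)
    then show ?thesis
      by (rule continuous_transform_within[where \<delta> = "\<bar>x\<bar>"])
        (use False x in \<open>auto simp: V_def dist_real_def\<close>)
  qed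
  then have "continuous_on ?S V" by (simp add: continuous_on_eq_continuous_within)
  with dU have "C1_on ?S U" unfolding C1_on_def by blast
  then show ?thesis by (simp add: U_def)
qed

lemma C1_on_divide:
  assumes "C1_on S U" "C1_on S G" "\<And>x. x \<in> S \<Longrightarrow> G x \<noteq> 0"
  shows "C1_on S (\<lambda>x. U x / G x)"
proof -
  obtain V where V: "\<And>x. x \<in> S \<Longrightarrow> (U has_real_derivative V x) (at x within S)"
      "continuous_on S V" using assms(1) unfolding C1_on_def by blast
  obtain H where H: "\<And>x. x \<in> S \<Longrightarrow> (G has_real_derivative H x) (at x within S)"
      "continuous_on S H" using assms(2) unfolding C1_on_def by blast
  let ?D = "\<lambda>x. (V x * G x - U x * H x) / (G x * G x)"
  have "continuous_on S U" "continuous_on S G"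
    by (rule DERIV_continuous_on[OF V(1)], assumption) (rule DERIV_continuous_on[OF H(1)])
  then have "continuous_on S ?D"
    by (intro continuous_intros V(2) H(2)) (simp_all add: assms(3))
  moreover have "((\<lambda>x. U x / G x) has_real_derivative ?D x) (at x within S)" if "x \<in> S" for x
    by (rule DERIV_divide[OF V(1)[OF that] H(1)[OF that] assms(3)[OF that]])
  ultimately show ?thesis unfolding C1_on_def by (intro exI[of _ ?D]) simp
qed

text \<open>The quotient \<open>u / f\<close> equals \<open>(u / x) / (f / x)\<close>, whose denominator is \<open>f'(0)\<close> at \<open>0\<close>.\<close>
lemma C1_quotient_at_simple_zero:
  fixes u u1 u2 f f1 f2 :: "real \<Rightarrow> real" and c :: real
  assumes c: "c > 0" and u0: "u 0 = 0" and f0: "f 0 = 0"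
    and u: "\<And>x. x \<in> {-c..c} \<Longrightarrow> (u has_real_derivative u1 x) (at x within {-c..c})"
      "\<And>x. x \<in> {-c..c} \<Longrightarrow> (u1 has_real_derivative u2 x) (at x within {-c..c})"
      "continuous_on {-c..c} u2"
    and f: "\<And>x. x \<in> {-c..c} \<Longrightarrow> (f has_real_derivative f1 x) (at x within {-c..c})"
      "\<And>x. x \<in> {-c..c} \<Longrightarrow> (f1 has_real_derivative f2 x) (at x within {-c..c})"
      "continuous_on {-c..c} f2"
    and simple: "f1 0 \<noteq> 0" and nz: "\<And>x. x \<in> {-c..c} \<Longrightarrow> x \<noteq> 0 \<Longrightarrow> f x \<noteq> 0"
  obtains h where "C1_on {-c..c} h" "\<And>x. x \<in> {-c..c} \<Longrightarrow> u x = f x * h x"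
proof
  let ?U = "\<lambda>x. if x = 0 then u1 0 else u x / x"
  let ?G = "\<lambda>x. if x = 0 then f1 0 else f x / x"
  show "C1_on {-c..c} (\<lambda>x. ?U x / ?G x)"
    using simple nz
    by (intro C1_on_divide C1_on_divide_ident[OF c u0 u] C1_on_divide_ident[OF c f0 f]) auto
  show "u x = f x * (?U x / ?G x)" if "x \<in> {-c..c}" for x
    using nz[OF that] u0 f0 by simp
qed

section \<open>The ground state substitution\<close>

text \<open>
  If \<open>f\<close> solves \<open>(B f')' + B W f = w\<close>, then expanding \<open>B ((f h)')\<^sup>2\<close> and collecting the terms
  without \<open>h'\<^sup>2\<close> into \<open>(B f f' h\<^sup>2)'\<close> turns the indefinite form into a square, up to the defect \<open>w\<close>.
  The defect is kept because the same \<open>f\<close> is used for every \<open>k\<close>, while it is an exact solution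
  only for \<open>k = \<plusminus>1\<close>.
\<close>
lemma ground_state_substitution:
  fixes b c :: real and w f g B W h D :: "real \<Rightarrow> real"
  assumes bc: "b \<le> c"
    and f: "\<And>s. s \<in> {b..c} \<Longrightarrow> (f has_real_derivative g s) (at s within {b..c})"
    and Bg: "\<And>s. s \<in> {b..c} \<Longrightarrow>
      ((\<lambda>s. B s * g s) has_real_derivative w s - B s * W s * f s) (at s within {b..c})"
    and h: "\<And>s. s \<in> {b..c} \<Longrightarrow> (h has_real_derivative D s) (at s within {b..c})"
    and cont: "continuous_on {b..c} w" "continuous_on {b..c} B" "continuous_on {b..c} D"
  shows "integral {b..c} (\<lambda>s. B s * (g s * h s + f s * D s)\<^sup>2 - B s * W s * (f s * h s)\<^sup>2)
    = (B c * f c * g c * (h c)\<^sup>2 - B b * f b * g b * (h b)\<^sup>2)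
      - integral {b..c} (\<lambda>s. w s * f s * (h s)\<^sup>2)
      + integral {b..c} (\<lambda>s. B s * (f s)\<^sup>2 * (D s)\<^sup>2)"
proof -
  let ?I = "{b..c}"
  \<comment> \<open>The boundary term \<open>?E\<close>, differentiated as the product of \<open>B f'\<close> and \<open>f h\<^sup>2\<close>.\<close>
  let ?E = "\<lambda>s. B s * f s * g s * (h s)\<^sup>2"
  let ?E' = "\<lambda>s. (w s - B s * W s * f s) * (f s * (h s)\<^sup>2)
    + B s * g s * (g s * (h s)\<^sup>2 + 2 * f s * h s * D s)"
  have "(?E has_real_derivative ?E' s) (at s within ?I)" if s: "s \<in> ?I" for s
  proof -
    have fh: "((\<lambda>s. f s * (h s)\<^sup>2) has_real_derivative
        g s * (h s)\<^sup>2 + 2 * f s * h s * D s) (at s within ?I)"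
      by (auto intro!: derivative_eq_intros f[OF s] h[OF s])
    have "((\<lambda>s. B s * g s * (f s * (h s)\<^sup>2)) has_real_derivative ?E' s) (at s within ?I)"
      using DERIV_mult[OF Bg[OF s] fh] by (simp add: algebra_simps)
    then show ?thesis by (simp add: mult_ac)
  qed
  then have E: "(?E' has_integral ?E c - ?E b) ?I"
    by (intro fundamental_theorem_of_calculus bc)
      (auto simp: has_real_derivative_iff_has_vector_derivative[symmetric])
  have ch: "continuous_on ?I h" "continuous_on ?I f"
    by (rule DERIV_continuous_on[OF h], assumption) (rule DERIV_continuous_on[OF f])
  have i1: "(\<lambda>s. w s * f s * (h s)\<^sup>2) integrable_on ?I"
    by (intro integrable_continuous_interval continuous_intros cont ch)
  have i2: "(\<lambda>s. B s * (f s)\<^sup>2 * (D s)\<^sup>2) integrable_on ?I"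
    by (intro integrable_continuous_interval continuous_intros cont ch)
  have "((\<lambda>s. ?E' s - w s * f s * (h s)\<^sup>2 + B s * (f s)\<^sup>2 * (D s)\<^sup>2) has_integral
      (?E c - ?E b) - integral ?I (\<lambda>s. w s * f s * (h s)\<^sup>2)
      + integral ?I (\<lambda>s. B s * (f s)\<^sup>2 * (D s)\<^sup>2)) ?I"
    by (intro has_integral_add has_integral_diff E integrable_integral i1 i2)
  moreover have "?E' s - w s * f s * (h s)\<^sup>2 + B s * (f s)\<^sup>2 * (D s)\<^sup>2
      = B s * (g s * h s + f s * D s)\<^sup>2 - B s * W s * (f s * h s)\<^sup>2" for s
    by (simp add: power2_eq_square algebra_simps)
  ultimately show ?thesis by (simp add: integral_unique)
qed

section \<open>The profile functions of the catenoid\<close>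

text \<open>The common numerator in \<open>A' = P / A\<close> and \<open>B' = P / B\<close>.\<close>
definition cat_P :: "real \<Rightarrow> real \<Rightarrow> real"
  where "cat_P a s = a * sinh (2 * s)"

text \<open>The time-like coordinate of the surface in the hyperboloid model.\<close>
definition cat_F :: "real \<Rightarrow> real \<Rightarrow> real"
  where "cat_F a s = cat_A a s * cosh (cat_phi a s)"

text \<open>
  The derivative of \<open>f\<^sub>*\<close>, in the form that \<open>\<Delta>F = 2F\<close> gives it: \<open>F'' = 2 F - (B' / B) F'\<close>. The
  next derivative then needs, besides \<open>F\<close> and \<open>f\<^sub>*\<close>, only that of the coefficient \<open>B' / B = P / B\<^sup>2\<close>.
\<close>
definition cat_g :: "real \<Rightarrow> real \<Rightarrow> real"
  where "cat_g a s = 2 * cat_F a s - cat_P a s / (cat_B a s)\<^sup>2 * f_star a s"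

context
  fixes a :: real
  assumes a: "a > 1 / 2"
begin

lemma cosh_gt_half: "a * cosh (2 * s) > 1 / 2"
proof -
  have "a * 1 \<le> a * cosh (2 * s)"
    using a by (intro mult_left_mono cosh_real_ge_1) auto
  then show ?thesis using a by linarith
qed

lemma cat_K_pos: "cat_K a > 0"
proof -
  have "(1 / 2)\<^sup>2 < a\<^sup>2" using a by (intro power_strict_mono) auto
  then show ?thesis unfolding cat_K_def by (simp add: power2_eq_square)
qed

lemma cat_A_pos: "cat_A a s > 0" and cat_B_pos: "cat_B a s > 0"
  using cosh_gt_half[of s] by (auto simp: cat_A_def cat_B_def)

lemma cat_K_sq: "(cat_K a)\<^sup>2 = a\<^sup>2 - 1 / 4"
  using cat_K_pos by (auto simp: cat_K_def)

lemma cat_A_sq: "(cat_A a s)\<^sup>2 = (cat_B a s)\<^sup>2 + 1"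
  and cat_B_sq: "(cat_B a s)\<^sup>2 = a * cosh (2 * s) - 1 / 2"
  using cosh_gt_half[of s] by (auto simp: cat_A_def cat_B_def)

text \<open>
  Together with \<open>A\<^sup>2 = B\<^sup>2 + 1\<close>, this is the only information about \<open>cosh (2 s)\<close> and \<open>sinh (2 s)\<close> that
  enters the algebraic identities below; the hyperbolic functions of
  \<open>2 s\<close> then drop out.
\<close>
lemma cat_P_sq: "(cat_P a s)\<^sup>2 = (cat_A a s)\<^sup>2 * (cat_B a s)\<^sup>2 - (cat_K a)\<^sup>2"
proof -
  have "(cat_P a s)\<^sup>2 = a\<^sup>2 * (cosh (2 * s))\<^sup>2 - a\<^sup>2"
    by (simp add: cat_P_def power_mult_distrib cosh_square_eq algebra_simps)
  then show ?thesis
    unfolding cat_A_sq cat_B_sq cat_K_sq by (simp add: power2_eq_square algebra_simps)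
qed

lemma cat_P_pos: "s > 0 \<Longrightarrow> cat_P a s > 0"
  using a by (simp add: cat_P_def)

lemma cat_B_strict_mono: "0 \<le> s \<Longrightarrow> s < t \<Longrightarrow> cat_B a s < cat_B a t"
  using a by (auto simp: cat_B_def intro!: cosh_real_strict_mono)

lemma DERIV_cat_A: "(cat_A a has_real_derivative cat_P a s / cat_A a s) (at s)"
proof -
  have "((\<lambda>s. sqrt (a * cosh (2 * s) + 1 / 2)) has_real_derivative
      a * sinh (2 * s) / sqrt (a * cosh (2 * s) + 1 / 2)) (at s)"
    using cosh_gt_half[of s] by (auto intro!: derivative_eq_intros simp: field_simps)
  then show ?thesis by (simp add: cat_A_def[abs_def] cat_P_def)
qed

lemma DERIV_cat_B: "(cat_B a has_real_derivative cat_P a s / cat_B a s) (at s)"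
proof -
  have "((\<lambda>s. sqrt (a * cosh (2 * s) - 1 / 2)) has_real_derivative
      a * sinh (2 * s) / sqrt (a * cosh (2 * s) - 1 / 2)) (at s)"
    using cosh_gt_half[of s] by (auto intro!: derivative_eq_intros simp: field_simps)
  then show ?thesis by (simp add: cat_B_def[abs_def] cat_P_def)
qed

lemma DERIV_cat_P: "(cat_P a has_real_derivative 2 * (cat_B a s)\<^sup>2 + 1) (at s)"
  unfolding cat_P_def[abs_def] cat_B_sq by (auto intro!: derivative_eq_intros)

lemma continuous_on_cat [continuous_intros]:
  "continuous_on S (cat_A a)" "continuous_on S (cat_B a)" "continuous_on S (cat_P a)"
  by (rule DERIV_continuous_on, rule DERIV_cat_A[THEN has_field_derivative_at_within]
      DERIV_cat_B[THEN has_field_derivative_at_within]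
      DERIV_cat_P[THEN has_field_derivative_at_within])+

lemma DERIV_cat_phi:
  "(cat_phi a has_real_derivative cat_K a / ((cat_A a s)\<^sup>2 * cat_B a s)) (at s)"
proof -
  \<comment> \<open>The integral is differentiated inside an interval containing both \<open>0\<close> and \<open>s\<close>.\<close>
  define l where "l = - \<bar>s\<bar> - 1"
  define u where "u = \<bar>s\<bar> + 1"
  let ?q = "\<lambda>t. cat_K a / ((cat_A a t)\<^sup>2 * cat_B a t)"
  have "continuous_on {l..u} ?q"
    using cat_A_pos cat_B_pos by (intro continuous_intros) (simp add: less_imp_neq[symmetric])
  then have "((\<lambda>s. LBINT t=(0::real)..s. ?q t) has_vector_derivative ?q s) (at s within {l..u})"
    by (intro interval_integral_FTC2) (auto simp: l_def u_def)
  moreover have "at s within {l..u} = at s"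
    by (rule at_within_interior) (auto simp: l_def u_def)
  ultimately show ?thesis
    by (simp add: cat_phi_def[abs_def] zero_ereal_def has_real_derivative_iff_has_vector_derivative)
qed

lemma cat_phi_0 [simp]: "cat_phi a 0 = 0"
  by (simp add: cat_phi_def zero_ereal_def)

lemma cat_phi_strict_mono:
  assumes "s < t"
  shows "cat_phi a s < cat_phi a t"
proof (rule DERIV_pos_imp_increasing[where f = "cat_phi a", OF assms])
  fix x
  have "0 < cat_K a / ((cat_A a x)\<^sup>2 * cat_B a x)"
    using cat_A_pos[of x] cat_B_pos[of x] cat_K_pos by simp
  with DERIV_cat_phi[of x] show "\<exists>y. (cat_phi a has_real_derivative y) (at x) \<and> 0 < y"
    by blast
qed

lemma cat_AB_minus [simp]:
  "cat_A a (- s) = cat_A a s" "cat_B a (- s) = cat_B a s" "cat_P a (- s) = - cat_P a s"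
  by (simp_all add: cat_A_def cat_B_def cat_P_def)

lemma cat_phi_minus [simp]: "cat_phi a (- s) = - cat_phi a s"
proof -
  have "((\<lambda>s. cat_phi a s + cat_phi a (- s)) has_real_derivative 0) (at x)" for x
  proof -
    have "((\<lambda>s. cat_phi a (- s)) has_real_derivative
        cat_K a / ((cat_A a (- x))\<^sup>2 * cat_B a (- x)) * (- 1)) (at x)"
      by (rule DERIV_chain2[where f = "cat_phi a" and g = uminus, OF DERIV_cat_phi])
        (auto intro!: derivative_eq_intros)
    from DERIV_add[OF DERIV_cat_phi this] show ?thesis by simp
  qed
  then have "cat_phi a s + cat_phi a (- s) = cat_phi a 0 + cat_phi a (- 0)"
    by (rule DERIV_isconst_all[of "\<lambda>s. cat_phi a s + cat_phi a (- s)", OF allI])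
  then show ?thesis by simp
qed

section \<open>The Jacobi function\<close>

lemma DERIV_cat_F:
  "(cat_F a has_real_derivative
    (cat_P a s * cosh (cat_phi a s) + cat_K a * sinh (cat_phi a s) / cat_B a s) / cat_A a s) (at s)"
  unfolding cat_F_def[abs_def] using cat_A_pos[of s] cat_B_pos[of s]
  by (auto intro!: derivative_eq_intros DERIV_cat_A DERIV_cat_phi
      simp: field_simps power2_eq_square)

lemma f_star_eq:
  "f_star a s =
    (cat_P a s * cosh (cat_phi a s) + cat_K a * sinh (cat_phi a s) / cat_B a s) / cat_A a s"
  using DERIV_imp_deriv[OF DERIV_cat_F[of s]] by (simp add: f_star_def cat_F_def[abs_def])

lemma DERIV_F: "(cat_F a has_real_derivative f_star a s) (at s)"
  using DERIV_cat_F by (simp add: f_star_eq)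

text \<open>
  This is \<open>\<Delta>F = 2F\<close>: after clearing denominators, the coefficients of \<open>cosh \<phi>\<close> and
  \<open>sinh \<phi>\<close> agree by the relations between \<open>A\<close>, \<open>B\<close>, \<open>P\<close> and \<open>K\<close>.
\<close>
lemma DERIV_f_star: "(f_star a has_real_derivative cat_g a s) (at s)"
proof -
  define A B P K C S where abbrs: "A = cat_A a s" "B = cat_B a s" "P = cat_P a s" "K = cat_K a"
    "C = cosh (cat_phi a s)" "S = sinh (cat_phi a s)"
  have pos: "A \<noteq> 0" "B \<noteq> 0" using cat_A_pos[of s] cat_B_pos[of s] by (auto simp: abbrs)
  have A2: "A\<^sup>2 = B\<^sup>2 + 1" and P2: "P\<^sup>2 = A\<^sup>2 * B\<^sup>2 - K\<^sup>2"
    using cat_A_sq[of s] cat_P_sq[of s] by (auto simp: abbrs)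
  have fe: "f_star a = (\<lambda>s. (cat_P a s * cosh (cat_phi a s)
      + cat_K a * sinh (cat_phi a s) / cat_B a s) / cat_A a s)"
    by (rule ext) (rule f_star_eq)
  let ?N = "(2 * B\<^sup>2 + 1) * C + P * (S * (K / (A\<^sup>2 * B)))
      + (K * (C * (K / (A\<^sup>2 * B))) * B - K * S * (P / B)) / (B * B)"
  have "(f_star a has_real_derivative
      (?N * A - (P * C + K * S / B) * (P / A)) / (A * A)) (at s)"
    unfolding fe abbrs using cat_A_pos[of s] cat_B_pos[of s]
    by (auto intro!: derivative_eq_intros DERIV_cat_A DERIV_cat_B DERIV_cat_P DERIV_cat_phi
      simp: less_imp_neq[symmetric] mult_ac)
  moreover have "(?N * A - (P * C + K * S / B) * (P / A)) / (A * A)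
      = 2 * (A * C) - P / B\<^sup>2 * ((P * C + K * S / B) / A)"
  proof -
    have "A ^ 3 * B ^ 3 * ((?N * A - (P * C + K * S / B) * (P / A)) / (A * A))
        = C * (A\<^sup>2 * B ^ 3 * (2 * B\<^sup>2 + 1) + K\<^sup>2 * B - P\<^sup>2 * B ^ 3) - K * S * P * A\<^sup>2"
      using pos by (simp add: field_simps power2_eq_square power3_eq_cube)
    also have "\<dots> = A ^ 3 * B ^ 3 * (2 * (A * C) - P / B\<^sup>2 * ((P * C + K * S / B) / A))"
    proof -
      have "A ^ 3 * B ^ 3 * (2 * (A * C) - P / B\<^sup>2 * ((P * C + K * S / B) / A))
          = C * (2 * (A\<^sup>2)\<^sup>2 * B ^ 3 - P\<^sup>2 * A\<^sup>2 * B) - K * S * P * A\<^sup>2"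
        using pos by (simp add: field_simps power2_eq_square power3_eq_cube)
      also have "2 * (A\<^sup>2)\<^sup>2 * B ^ 3 - P\<^sup>2 * A\<^sup>2 * B
          = A\<^sup>2 * B ^ 3 * (2 * B\<^sup>2 + 1) + K\<^sup>2 * B - P\<^sup>2 * B ^ 3"
        unfolding P2 A2 by (simp add: algebra_simps power2_eq_square power3_eq_cube)
      finally show ?thesis by simp
    qed
    finally show ?thesis
      by (rule mult_left_cancel[THEN iffD1, rotated]) (use pos in simp)
  qed
  ultimately show ?thesis
    by (simp add: cat_g_def cat_F_def f_star_eq abbrs)
qed

text \<open>
  The derivative of \<open>B' / B\<close> is \<open>|II|\<^sup>2 - 1 / B\<^sup>2 = W\<^sub>1 + 2\<close>. This identity makes the potential of
  the index form appear when \<open>\<Delta>F = 2F\<close> is differentiated.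
\<close>
lemma DERIV_cat_P_over_B_sq:
  "((\<lambda>s. cat_P a s / (cat_B a s)\<^sup>2) has_real_derivative
    2 * (cat_K a)\<^sup>2 / cat_B a s ^ 4 - 1 / (cat_B a s)\<^sup>2) (at s)"
proof -
  define B P where abbrs: "B = cat_B a s" "P = cat_P a s"
  have pos: "B > 0" using cat_B_pos[of s] by (simp add: abbrs)
  have "((\<lambda>s. cat_P a s / (cat_B a s)\<^sup>2) has_real_derivative
      ((2 * B\<^sup>2 + 1) * B\<^sup>2 - P * (2 * B * (P / B))) / (B\<^sup>2 * B\<^sup>2)) (at s)"
    unfolding abbrs using cat_B_pos[of s]
    by (auto intro!: derivative_eq_intros DERIV_cat_B DERIV_cat_P)
  also have "((2 * B\<^sup>2 + 1) * B\<^sup>2 - P * (2 * B * (P / B))) / (B\<^sup>2 * B\<^sup>2)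
      = ((2 * B\<^sup>2 + 1) * B\<^sup>2 - 2 * P\<^sup>2) / B ^ 4"
    using pos by (simp add: power2_eq_square power4_eq_xxxx mult_ac)
  also have "\<dots> = (2 * (cat_K a)\<^sup>2 - B\<^sup>2) / B ^ 4"
    unfolding abbrs cat_P_sq cat_A_sq by (simp add: algebra_simps)
  also have "\<dots> = 2 * (cat_K a)\<^sup>2 / B ^ 4 - 1 / B\<^sup>2"
    using pos by (simp add: field_simps power2_eq_square power4_eq_xxxx)
  finally show ?thesis by (simp add: abbrs)
qed

lemma DERIV_cat_g:
  "(cat_g a has_real_derivative
    - cat_W a 1 s * f_star a s - cat_P a s / (cat_B a s)\<^sup>2 * cat_g a s) (at s)"
proof -
  have "cat_g a = (\<lambda>s. 2 * cat_F a s - cat_P a s / (cat_B a s)\<^sup>2 * f_star a s)"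
    by (rule ext) (rule cat_g_def)
  then show ?thesis
    using DERIV_diff[OF DERIV_cmult[OF DERIV_F, of 2 s]
        DERIV_mult[OF DERIV_cat_P_over_B_sq DERIV_f_star, of s]]
    by (simp add: cat_W_def cat_II_sq_def algebra_simps)
qed

lemma jacobi_equation:
  "((\<lambda>s. cat_B a s * cat_g a s) has_real_derivative
    - (cat_B a s * cat_W a 1 s * f_star a s)) (at s)"
  using DERIV_mult[OF DERIV_cat_B[of s] DERIV_cat_g[of s]] cat_B_pos[of s]
  by (simp add: field_simps power2_eq_square)

lemma cat_W_shift:
  "cat_B a s * cat_W a 1 s = cat_B a s * cat_W a k s + ((of_int k)\<^sup>2 - 1) / cat_B a s"
  using cat_B_pos[of s] by (simp add: cat_W_def field_simps power2_eq_square)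

lemma cat_F_minus: "cat_F a (- s) = cat_F a s"
  and f_star_minus: "f_star a (- s) = - f_star a s"
  by (simp_all add: cat_F_def f_star_eq add_divide_distrib diff_divide_distrib)

lemma cat_g_minus: "cat_g a (- s) = cat_g a s"
  by (simp add: cat_g_def cat_F_minus f_star_minus)

lemma f_star_0: "f_star a 0 = 0"
  by (simp add: f_star_eq cat_P_def)

lemma f_star_pos: "s > 0 \<Longrightarrow> f_star a s > 0"
  using cat_phi_strict_mono[of 0 s] cat_A_pos[of s] cat_B_pos[of s] cat_P_pos[of s] cat_K_pos
  by (auto simp: f_star_eq intro!: divide_pos_pos add_pos_pos mult_pos_pos cosh_real_pos)

lemma f_star_nonzero: "s \<noteq> 0 \<Longrightarrow> f_star a s \<noteq> 0"
  using f_star_pos[of s] f_star_pos[of "- s"] f_star_minus[of s] by (cases "s > 0") auto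

lemma cat_g_0_pos: "cat_g a 0 > 0"
  using cat_A_pos[of 0] by (simp add: cat_g_def cat_F_def f_star_0)

section \<open>The free boundary condition\<close>

text \<open>
  With \<open>x = B\<^sup>2\<close>, the square of the ratio is \<open>K\<^sup>2 x / (x\<^sup>2 + x - K\<^sup>2)\<close>, which decreases in \<open>x\<close>, and
  \<open>B\<close> increases.
\<close>
lemma boundary_ratio_strict_antimono:
  assumes "0 < s" "s < t"
  shows "cat_B a t * cat_K a / cat_P a t < cat_B a s * cat_K a / cat_P a s"
proof (rule power_less_imp_less_base[where n = 2])
  define x y where xy: "x = (cat_B a s)\<^sup>2" "y = (cat_B a t)\<^sup>2"
  have xpos: "x > 0" and xy_less: "x < y"
    using cat_B_pos[of s] cat_B_strict_mono[of s t] assms by (auto simp: xy power_strict_mono)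
  have P: "(cat_P a s)\<^sup>2 = x\<^sup>2 + x - (cat_K a)\<^sup>2" "(cat_P a t)\<^sup>2 = y\<^sup>2 + y - (cat_K a)\<^sup>2"
    unfolding cat_P_sq cat_A_sq xy by (simp_all add: power2_eq_square algebra_simps)
  have Ppos: "(cat_P a s)\<^sup>2 > 0" "(cat_P a t)\<^sup>2 > 0"
    using cat_P_pos assms by (simp_all add: less_imp_neq[symmetric])
  have "x * (cat_P a t)\<^sup>2 - y * (cat_P a s)\<^sup>2 = (y - x) * (x * y + (cat_K a)\<^sup>2)"
    unfolding P by (simp add: power2_eq_square algebra_simps)
  also have "\<dots> > 0"
    using xpos xy_less by (intro mult_pos_pos add_pos_nonneg) auto
  finally have "y / (cat_P a t)\<^sup>2 < x / (cat_P a s)\<^sup>2"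
    using Ppos by (simp add: divide_less_eq less_divide_eq field_simps)
  then have "y / (cat_P a t)\<^sup>2 * (cat_K a)\<^sup>2 < x / (cat_P a s)\<^sup>2 * (cat_K a)\<^sup>2"
    using cat_K_pos by (intro mult_strict_right_mono) auto
  then show "(cat_B a t * cat_K a / cat_P a t)\<^sup>2 < (cat_B a s * cat_K a / cat_P a s)\<^sup>2"
    by (simp add: power_divide power_mult_distrib xy)
  show "0 \<le> cat_B a s * cat_K a / cat_P a s"
    using cat_B_pos[of s] cat_K_pos cat_P_pos[OF assms(1)] by simp
qed

text \<open>
  Existence comes from the intermediate value theorem, uniqueness from the opposite monotonicity of
  the two sides.
\<close>
lemma ex1_critical_parameter:
  "\<exists>!s. s > 0 \<and> tanh (cat_phi a s) = cat_B a s * cat_K a / (a * sinh (2 * s))"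
proof -
  have phi1: "tanh (cat_phi a 1) > 0"
    using cat_phi_strict_mono[of 0 1] by simp
  have "((\<lambda>s. sqrt (a * cosh (2 * s) - 1 / 2) * cat_K a / (a * sinh (2 * s))) \<longlongrightarrow> 0) at_top"
    using a cat_K_pos by real_asymp
  then have "eventually (\<lambda>s. cat_B a s * cat_K a / cat_P a s < tanh (cat_phi a 1)) at_top"
    unfolding cat_B_def cat_P_def by (rule order_tendstoD) (rule phi1)
  then have "eventually (\<lambda>s. s > 1 \<and> cat_B a s * cat_K a / cat_P a s < tanh (cat_phi a 1)) at_top"
    using eventually_gt_at_top[of 1] by eventually_elim auto
  then obtain s1 where s1: "s1 > 1" "cat_B a s1 * cat_K a / cat_P a s1 < tanh (cat_phi a 1)"
    using eventually_happens[of _ at_top] by force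
  \<comment> \<open>The equation multiplied by \<open>P\<close>, so that it makes sense at \<open>s = 0\<close>, where the ratio has a
    pole.\<close>
  define d where "d = (\<lambda>s. tanh (cat_phi a s) * cat_P a s - cat_B a s * cat_K a)"
  have "cat_B a s1 * cat_K a / cat_P a s1 < tanh (cat_phi a s1)"
    using s1 cat_phi_strict_mono[of 1 s1] by (meson less_trans tanh_real_less_iff)
  then have d1: "d s1 > 0"
    using cat_P_pos[of s1] s1 by (simp add: d_def field_simps)
  have d0: "d 0 < 0"
    using cat_B_pos[of 0] cat_K_pos by (simp add: d_def cat_P_def)
  have "continuous_on {0..s1} (cat_phi a)"
    by (rule DERIV_continuous_on) (rule DERIV_cat_phi[THEN has_field_derivative_at_within])
  then have "continuous_on {0..s1} d"
    unfolding d_def by (intro continuous_intros) auto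
  then obtain s where s: "0 \<le> s" "s \<le> s1" "d s = 0"
    using IVT'[of d 0 0 s1] d0 d1 s1 by force
  then have "s > 0" using d0 by (cases "s = 0") auto
  then have sol: "s > 0 \<and> tanh (cat_phi a s) = cat_B a s * cat_K a / cat_P a s"
    using s cat_P_pos[of s] by (simp add: d_def field_simps)
  have no_two: False
    if "0 < s" "s < t" "tanh (cat_phi a s) = cat_B a s * cat_K a / cat_P a s"
      "tanh (cat_phi a t) = cat_B a t * cat_K a / cat_P a t" for s t
  proof -
    have "tanh (cat_phi a s) < tanh (cat_phi a t)"
      using cat_phi_strict_mono[OF that(2)] by simp
    with boundary_ratio_strict_antimono[of s t] that show ?thesis by simp
  qed
  show ?thesis
    unfolding cat_P_def[symmetric]
    by (rule ex1I[where a = s], rule sol) (use sol no_two in \<open>metis linorder_neqE_linordered_idom\<close>)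
qed

lemma cat_s0_pos: "cat_s0 a > 0"
  and cat_s0_eq: "tanh (cat_phi a (cat_s0 a))
    = cat_B a (cat_s0 a) * cat_K a / cat_P a (cat_s0 a)"
  using theI'[OF ex1_critical_parameter] unfolding cat_s0_def cat_P_def by auto

text \<open>
  The equation is \<open>P sinh \<phi> = B K cosh \<phi>\<close>. It simplifies \<open>f\<^sub>*\<close> to \<open>A B\<^sup>2 cosh \<phi> / P\<close>, from which both
  claims follow with the relations between \<open>A\<close>, \<open>B\<close>, \<open>P\<close> and \<open>K\<close>. Geometrically, the surface meets
  a sphere centred at the origin of the hyperboloid orthogonally.
\<close>
lemma boundary_data:
  fixes s :: real
  assumes s: "s > 0" and eq: "tanh (cat_phi a s) = cat_B a s * cat_K a / cat_P a s"
  shows "(cat_F a s)\<^sup>2 = (f_star a s)\<^sup>2 + 1" and "cat_g a s = cat_F a s"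
proof -
  define A B P K C S where abbrs: "A = cat_A a s" "B = cat_B a s" "P = cat_P a s" "K = cat_K a"
    "C = cosh (cat_phi a s)" "S = sinh (cat_phi a s)"
  have pos: "A > 0" "B > 0" "P > 0" "K > 0"
    using cat_A_pos cat_B_pos cat_P_pos[OF s] cat_K_pos by (auto simp: abbrs)
  have A2: "A\<^sup>2 = B\<^sup>2 + 1" and P2: "P\<^sup>2 = A\<^sup>2 * B\<^sup>2 - K\<^sup>2" and C2: "C\<^sup>2 = S\<^sup>2 + 1"
    using cat_A_sq[of s] cat_P_sq[of s] by (auto simp: abbrs cosh_square_eq)
  have "S / C = B * K / P" using eq by (simp add: abbrs tanh_def)
  then have PS: "P * S = B * K * C"
    using pos by (simp add: abbrs field_simps)
  have f: "f_star a s = (P * C + K * S / B) / A" by (simp add: f_star_eq abbrs)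
  have "P * B * (P * C + K * S / B) = B * C * P\<^sup>2 + K * (P * S)"
    using pos by (simp add: field_simps power2_eq_square)
  also have "\<dots> = B * C * (A\<^sup>2 * B\<^sup>2)"
    unfolding PS P2 by (simp add: power2_eq_square algebra_simps)
  finally have "B * (P * (P * C + K * S / B)) = B * (A\<^sup>2 * B\<^sup>2 * C)"
    by (simp only: mult_ac)
  then have "P * (P * C + K * S / B) = A\<^sup>2 * B\<^sup>2 * C"
    by (rule mult_left_cancel[THEN iffD1, rotated]) (use pos in simp)
  then have f_simple: "P * f_star a s = A * B\<^sup>2 * C"
    using pos by (simp add: f field_simps power2_eq_square)
  have g: "cat_g a s = 2 * (A * C) - P * f_star a s / B\<^sup>2"
    by (simp add: cat_g_def cat_F_def abbrs)
  show "cat_g a s = cat_F a s"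
    unfolding g f_simple using pos by (simp add: cat_F_def abbrs)
  have "(P * S)\<^sup>2 = (B * K * C)\<^sup>2" using PS by simp
  then have q: "P\<^sup>2 * (C\<^sup>2 - 1) = B\<^sup>2 * K\<^sup>2 * C\<^sup>2"
    by (simp add: power_mult_distrib C2)
  have "P\<^sup>2 * ((f_star a s)\<^sup>2 + 1) = (A * B\<^sup>2 * C)\<^sup>2 + P\<^sup>2"
    using arg_cong[OF f_simple, of "\<lambda>x. x\<^sup>2"] by (simp add: power_mult_distrib algebra_simps)
  also have "\<dots> = A\<^sup>2 * B\<^sup>2 * (B\<^sup>2 * C\<^sup>2) + P\<^sup>2" by (simp add: power2_eq_square)
  also have "\<dots> = (P\<^sup>2 + K\<^sup>2) * (B\<^sup>2 * C\<^sup>2) + P\<^sup>2" by (simp add: P2)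
  also have "\<dots> = P\<^sup>2 * B\<^sup>2 * C\<^sup>2 + P\<^sup>2 * (C\<^sup>2 - 1) + P\<^sup>2"
    unfolding q by (simp add: algebra_simps)
  also have "\<dots> = P\<^sup>2 * (A\<^sup>2 * C\<^sup>2)"
    by (simp add: A2 algebra_simps)
  finally show "(cat_F a s)\<^sup>2 = (f_star a s)\<^sup>2 + 1"
    using pos by (simp add: cat_F_def abbrs power_mult_distrib)
qed

text \<open>
  The radius is found from its hyperbolic sine, because \<open>F\<^sup>2 = f\<^sub>*\<^sup>2 + 1\<close> then gives the hyperbolic
  cosine.
\<close>
lemma cat_r_spec:
  "cosh (cat_r a) = cat_F a (cat_s0 a)" "sinh (cat_r a) = f_star a (cat_s0 a)"
proof -
  let ?s = "cat_s0 a"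
  define r where "r = arsinh (f_star a ?s)"
  have f: "f_star a ?s > 0" by (rule f_star_pos[OF cat_s0_pos])
  have sinh_r: "sinh r = f_star a ?s" by (simp add: r_def)
  have "(cosh r)\<^sup>2 = (cat_F a ?s)\<^sup>2"
    using boundary_data(1)[OF cat_s0_pos cat_s0_eq] by (simp add: cosh_square_eq sinh_r)
  moreover have "cat_F a ?s > 0" using cat_A_pos by (simp add: cat_F_def)
  ultimately have cosh_r: "cosh r = cat_F a ?s"
    by (simp add: power2_eq_iff_nonneg)
  have r_pos: "r > 0" using f sinh_r by (metis sinh_real_pos_iff)
  have "cat_r a = r"
    unfolding cat_r_def
  proof (rule the_equality)
    show "r > 0 \<and> cosh r = cat_A a ?s * cosh (cat_phi a ?s)"
      using r_pos cosh_r by (simp add: cat_F_def)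
    show "t = r" if "t > 0 \<and> cosh t = cat_A a ?s * cosh (cat_phi a ?s)" for t
      using that r_pos cosh_r arcosh_cosh_real[of t] arcosh_cosh_real[of r]
      by (simp add: cat_F_def)
  qed
  then show "cosh (cat_r a) = cat_F a ?s" "sinh (cat_r a) = f_star a ?s"
    using cosh_r sinh_r by auto
qed

text \<open>The natural boundary condition of the index form, satisfied because \<open>f\<^sub>*' = F\<close> at \<open>s\<^sub>0\<close>.\<close>
lemma robin_condition:
  "cat_g a (cat_s0 a) = coth (cat_r a) * f_star a (cat_s0 a)"
  using boundary_data(2)[OF cat_s0_pos cat_s0_eq] f_star_pos[OF cat_s0_pos]
  by (simp add: coth_def cat_r_spec)

section \<open>The index form\<close>

lemma deriv_within_cat_I:
  assumes "s \<in> cat_I a" "(u has_real_derivative d) (at s within cat_I a)"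
  shows "deriv_within (cat_I a) u s = d"
  using assms cat_s0_pos unfolding deriv_within_def cat_I_def
  by (intro vector_derivative_within_closed_interval)
    (auto simp: has_real_derivative_iff_has_vector_derivative)

lemma continuous_on_f_star: "continuous_on S (f_star a)"
  and continuous_on_cat_g: "continuous_on S (cat_g a)"
  by (rule DERIV_continuous_on, rule DERIV_f_star[THEN has_field_derivative_at_within]
      DERIV_cat_g[THEN has_field_derivative_at_within])+

lemma factorization:
  assumes u: "smooth_on (cat_I a) u" and u0: "u 0 = 0"
  obtains h where "C1_on (cat_I a) h" "\<And>s. s \<in> cat_I a \<Longrightarrow> u s = f_star a s * h s"
proof -
  obtain D :: "nat \<Rightarrow> real \<Rightarrow> real" where D0: "\<And>x. x \<in> cat_I a \<Longrightarrow> D 0 x = u x"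
    and D: "\<And>n x. x \<in> cat_I a \<Longrightarrow> (D n has_real_derivative D (Suc n) x) (at x within cat_I a)"
    using u unfolding smooth_on_def by blast
  have "continuous_on (cat_I a) (D 2)"
    using D[of _ 2] by (auto intro: DERIV_continuous_on)
  moreover have "D 0 0 = 0" using D0[of 0] u0 cat_s0_pos by (simp add: cat_I_def)
  moreover have "continuous_on (cat_I a)
      (\<lambda>s. - cat_W a 1 s * f_star a s - cat_P a s / (cat_B a s)\<^sup>2 * cat_g a s)"
    unfolding cat_W_def cat_II_sq_def using cat_B_pos
    by (intro continuous_intros continuous_on_f_star continuous_on_cat_g)
      (simp_all add: less_imp_neq[symmetric])
  ultimately obtain h where "C1_on (cat_I a) h"
    and "\<And>x. x \<in> cat_I a \<Longrightarrow> D 0 x = f_star a x * h x"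
    using C1_quotient_at_simple_zero[of "cat_s0 a" "D 0" "f_star a" "D 1" "D 2" "cat_g a"
        "\<lambda>s. - cat_W a 1 s * f_star a s - cat_P a s / (cat_B a s)\<^sup>2 * cat_g a s"]
      D[of _ 0] D[of _ 1] cat_s0_pos f_star_0 cat_g_0_pos f_star_nonzero
      DERIV_f_star[THEN has_field_derivative_at_within] DERIV_cat_g[THEN has_field_derivative_at_within]
    by (simp add: cat_I_def[symmetric] numeral_2_eq_2) blast
  then show ?thesis using D0 by (intro that) auto
qed

lemma S_rad_factorized:
  assumes h: "C1_on (cat_I a) h" and u: "\<And>s. s \<in> cat_I a \<Longrightarrow> u s = f_star a s * h s"
  shows "S_rad a k u =
    ((of_int k)\<^sup>2 - 1) * integral (cat_I a) (\<lambda>s. (f_star a s)\<^sup>2 / cat_B a s * (h s)\<^sup>2)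
    + integral (cat_I a)
        (\<lambda>s. cat_B a s * (f_star a s)\<^sup>2 * (deriv_within (cat_I a) h s)\<^sup>2)"
proof -
  let ?I = "cat_I a" and ?s = "cat_s0 a"
  obtain D where D: "\<And>x. x \<in> ?I \<Longrightarrow> (h has_real_derivative D x) (at x within ?I)"
    and contD: "continuous_on ?I D"
    using h unfolding C1_on_def by blast
  \<comment> \<open>The defect \<open>B (W\<^sub>k - W\<^sub>1) f\<^sub>*\<close> of the Jacobi equation for \<open>k\<close>.\<close>
  define w where "w = (\<lambda>s. - ((of_int k)\<^sup>2 - 1) / cat_B a s * f_star a s)"
  have contw: "continuous_on ?I w"
    unfolding w_def using cat_B_pos
    by (intro continuous_intros continuous_on_f_star) (simp add: less_imp_neq[symmetric])
  have jac: "((\<lambda>s. cat_B a s * cat_g a s) has_real_derivative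
      w s - cat_B a s * cat_W a k s * f_star a s) (at s within ?I)" for s
  proof -
    have "- (cat_B a s * cat_W a 1 s * f_star a s) = w s - cat_B a s * cat_W a k s * f_star a s"
      unfolding cat_W_shift[of s k] w_def by (simp add: algebra_simps diff_divide_distrib)
    then show ?thesis using jacobi_equation[of s] by (metis has_field_derivative_at_within)
  qed
  have u': "deriv_within ?I u s = cat_g a s * h s + f_star a s * D s" if s: "s \<in> ?I" for s
  proof (rule deriv_within_cat_I[OF s])
    have "((\<lambda>s. f_star a s * h s) has_real_derivative cat_g a s * h s + f_star a s * D s)
        (at s within ?I)"
      by (rule derivative_eq_intros D s DERIV_f_star[THEN has_field_derivative_at_within] refl)+ simp
    then show "(u has_real_derivative cat_g a s * h s + f_star a s * D s) (at s within ?I)"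
      by (rule has_field_derivative_transform_within[of _ _ _ _ 1]) (use s u in auto)
  qed
  have ends: "?s \<in> ?I" "- ?s \<in> ?I" using cat_s0_pos by (auto simp: cat_I_def)
  have "integral ?I (\<lambda>s. cat_B a s * (deriv_within ?I u s)\<^sup>2 - cat_B a s * cat_W a k s * (u s)\<^sup>2)
      = integral ?I (\<lambda>s. cat_B a s * (cat_g a s * h s + f_star a s * D s)\<^sup>2
          - cat_B a s * cat_W a k s * (f_star a s * h s)\<^sup>2)"
    by (rule integral_cong) (simp add: u u')
  also have "\<dots> = (cat_B a ?s * f_star a ?s * cat_g a ?s * (h ?s)\<^sup>2
        - cat_B a (- ?s) * f_star a (- ?s) * cat_g a (- ?s) * (h (- ?s))\<^sup>2)
      - integral ?I (\<lambda>s. w s * f_star a s * (h s)\<^sup>2)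
      + integral ?I (\<lambda>s. cat_B a s * (f_star a s)\<^sup>2 * (D s)\<^sup>2)"
    unfolding cat_I_def
    by (rule ground_state_substitution)
      (use D jac contD contw cat_s0_pos continuous_on_cat
        DERIV_f_star[THEN has_field_derivative_at_within] in \<open>auto simp: cat_I_def\<close>)
  also have "cat_B a ?s * f_star a ?s * cat_g a ?s * (h ?s)\<^sup>2
        - cat_B a (- ?s) * f_star a (- ?s) * cat_g a (- ?s) * (h (- ?s))\<^sup>2
      = coth (cat_r a) * cat_B a ?s * ((u ?s)\<^sup>2 + (u (- ?s))\<^sup>2)"
    by (simp add: u ends f_star_minus cat_g_minus robin_condition power2_eq_square algebra_simps)
  also have "integral ?I (\<lambda>s. w s * f_star a s * (h s)\<^sup>2)
      = - ((of_int k)\<^sup>2 - 1) * integral ?I (\<lambda>s. (f_star a s)\<^sup>2 / cat_B a s * (h s)\<^sup>2)"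
    unfolding integral_mult_right[symmetric]
    by (rule integral_cong) (simp add: w_def power2_eq_square)
  also have "integral ?I (\<lambda>s. cat_B a s * (f_star a s)\<^sup>2 * (D s)\<^sup>2)
      = integral ?I (\<lambda>s. cat_B a s * (f_star a s)\<^sup>2 * (deriv_within ?I h s)\<^sup>2)"
    by (rule integral_cong) (simp add: deriv_within_cat_I[OF _ D])
  finally show ?thesis by (simp add: S_rad_def left_diff_distrib)
qed

end

theorem theorem1:
  fixes a :: real and k :: int and u :: "real \<Rightarrow> real"
  assumes "a > 1 / 2"
    and "smooth_on (cat_I a) u"
    and "u 0 = 0"
  shows "(\<exists>h. C1_on (cat_I a) h \<and> (\<forall>s\<in>cat_I a. u s = f_star a s * h s)) \<and>
    (\<forall>h. C1_on (cat_I a) h \<and> (\<forall>s\<in>cat_I a. u s = f_star a s * h s) \<longrightarrow>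
      S_rad a k u =
        ((of_int k)\<^sup>2 - 1) * integral (cat_I a) (\<lambda>s. (f_star a s)\<^sup>2 / cat_B a s * (h s)\<^sup>2)
        + integral (cat_I a)
            (\<lambda>s. cat_B a s * (f_star a s)\<^sup>2 * (deriv_within (cat_I a) h s)\<^sup>2))"
proof (intro conjI allI impI)
  obtain h where "C1_on (cat_I a) h" "\<And>s. s \<in> cat_I a \<Longrightarrow> u s = f_star a s * h s"
    using factorization[OF assms] by blast
  then show "\<exists>h. C1_on (cat_I a) h \<and> (\<forall>s\<in>cat_I a. u s = f_star a s * h s)" by blast
qed (use S_rad_factorized[OF assms(1)] in blast)

end
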